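(* Let $\Phi=(\phi_j)_{1\le j\le N}$ be a sequence of nonzero elements of a real vector space $F$, generating $F$ and spanning a salient cone $\mathfrak c(\Phi)$, and let $\tau\subset\mathfrak c(\Phi)$ be a $\Phi$-tope. (i) If $\lambda$ belongs to the closure $\overline\tau$ of $\tau$, then $$\mathcal X(\Phi,\tau)\,[V(\Phi,\lambda)]=[\mathfrak p(\Phi,\lambda)].$$ (ii) If $\lambda\in\tau-\mathfrak b(\Phi)$, then $$\mathcal X(\Phi,\tau)\,[V(\Phi,\lambda)]\,[\mathbb Z^N]=[\mathfrak p(\Phi,\lambda)\cap\mathbb Z^N].$$
   Context: $F$ is finite dimensional, $r=\dim F$; $\mathfrak c(\Phi)=\{\sum_i t_i\phi_i:t_i\ge 0\}$; a cone is salient if it contains no affine line. For $\lambda\in F$: $V(\Phi,\lambda)=\{x\in\mathbb R^N:\sum_i x_i\phi_i=\lambda\}$ and $\mathfrak p(\Phi,\lambda)=\{x\in V(\Phi,\lambda):x_i\ge 0\text{ for all }i\}$. $[E]$ denotes the characteristic function of $E\subseteq\mathbb R^N$. A $\Phi$-wall is a hyperplane of $F$ spanned by $r-1$ linearly independent elements of $\Phi$; a $\Phi$-tope is a connected component of the complement in $F$ of the union of all $\Phi$-walls. $\mathfrak b(\Phi)=\{\sum_{i=1}^N t_i\phi_i:0\le t_i\le 1\}$ and $\tau-\mathfrak b(\Phi)=\{u-v:u\in\tau,v\in\mathfrak b(\Phi)\}$. $\mathcal G(\Phi,\tau)$ is the set of $I\subseteq\{1,\dots,N\}$ such that $\{\phi_i,i\in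 I\}$ generates $F$ and $\tau$ is contained in the cone generated by $\{\phi_i,i\in I\}$. With $I^c$ the complement of $I$, $\mathcal X(\Phi,\tau)=\sum_{I\in\mathcal G(\Phi,\tau)}(-1)^{|I|-\dim F}\prod_{j\in I^c}[x_j\ge 0]$, a function on $\mathbb R^N$. *)

theory Defs
  imports "HOL-Analysis.Analysis"
begin

text \<open>
  The finite-dimensional space \<open>F\<close> is a type of class \<open>euclidean_space\<close>; its inner product is
  not used by any of the definitions, and its topology is the canonical one.  A sequence of
  \<open>N\<close> vectors is a function on a finite index type \<open>'n\<close> with \<open>N = CARD('n)\<close>,
  so that repetitions are allowed, and \<open>real ^ 'n\<close> is the coordinate space of dimension \<open>N\<close>.
\<close>

definition cone_gen :: "('n::finite \<Rightarrow> 'a::euclidean_space) \<Rightarrow> 'n set \<Rightarrow> 'a set" where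
  "cone_gen \<Phi> I = {\<Sum>i\<in>I. t i *\<^sub>R \<Phi> i |t. \<forall>i\<in>I. 0 \<le> t i}"

definition salient :: "'a::euclidean_space set \<Rightarrow> bool" where
  "salient C \<longleftrightarrow> \<not> (\<exists>p v. v \<noteq> 0 \<and> range (\<lambda>t::real. p + t *\<^sub>R v) \<subseteq> C)"

definition walls :: "('n::finite \<Rightarrow> 'a::euclidean_space) \<Rightarrow> 'a set set" where
  "walls \<Phi> = {span S |S. S \<subseteq> range \<Phi> \<and> independent S \<and> card S = DIM('a) - 1}"

definition topes :: "('n::finite \<Rightarrow> 'a::euclidean_space) \<Rightarrow> 'a set set" where
  "topes \<Phi> = components (UNIV - \<Union>(walls \<Phi>))"

definition zonotope :: "('n::finite \<Rightarrow> 'a::euclidean_space) \<Rightarrow> 'a set" where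
  "zonotope \<Phi> = {\<Sum>i\<in>UNIV. t i *\<^sub>R \<Phi> i |t. \<forall>i. 0 \<le> t i \<and> t i \<le> 1}"

definition fiber :: "('n::finite \<Rightarrow> 'a::euclidean_space) \<Rightarrow> 'a \<Rightarrow> (real ^ 'n) set" where
  "fiber \<Phi> l = {x. (\<Sum>i\<in>UNIV. (x $ i) *\<^sub>R \<Phi> i) = l}"

definition partition_polytope ::
    "('n::finite \<Rightarrow> 'a::euclidean_space) \<Rightarrow> 'a \<Rightarrow> (real ^ 'n) set" where
  "partition_polytope \<Phi> l = {x \<in> fiber \<Phi> l. \<forall>i. 0 \<le> x $ i}"

definition int_lattice :: "(real ^ 'n::finite) set" where
  "int_lattice = {x. \<forall>i. x $ i \<in> \<int>}"

definition gen_sets :: "('n::finite \<Rightarrow> 'a::euclidean_space) \<Rightarrow> 'a set \<Rightarrow> 'n set set" where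
  "gen_sets \<Phi> \<tau> = {I. span (\<Phi> ` I) = UNIV \<and> \<tau> \<subseteq> cone_gen \<Phi> I}"

text \<open>
  The truncated subtraction in the exponent is harmless: for \<open>I \<in> gen_sets \<Phi> \<tau>\<close>
  the vectors \<open>\<Phi> i\<close> with \<open>i \<in> I\<close> span the space, hence \<open>card I \<ge> DIM('a)\<close>.
\<close>

definition \<X> ::
    "('n::finite \<Rightarrow> 'a::euclidean_space) \<Rightarrow> 'a set \<Rightarrow> real ^ 'n \<Rightarrow> real" where
  "\<X> \<Phi> \<tau> x =
     (\<Sum>I\<in>gen_sets \<Phi> \<tau>.
        (-1) ^ (card I - DIM('a)) * (\<Prod>j\<in>-I. indicator {y. 0 \<le> y $ j} x))"

end

theory Submission
  imports Defs
begin

text \<open>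
  Write \<open>r\<close> for the dimension of the space.  At a point \<open>x\<close> the product in
  \<open>\<X> \<Phi> \<tau> x\<close> only depends on the set \<open>J\<close> of indices with \<open>x $ j < 0\<close>: it
  is \<open>1\<close> if \<open>J \<subseteq> I\<close> and \<open>0\<close> otherwise.  Moreover, a cone generated by members of
  \<open>\<Phi>\<close> contains the tope \<open>\<tau>\<close> as soon as it contains one point of \<open>\<tau>\<close>, because its
  boundary lies on walls (\<open>gen_sets_tope\<close>).  Hence, for an arbitrary \<open>u \<in> \<tau>\<close>,
  the value \<open>\<X> \<Phi> \<tau> x\<close> is \<open>(-1) ^ r\<close> times the sum of \<open>(-1) ^ card I\<close> over the sets
  \<open>I \<supseteq> J\<close> whose cone contains \<open>u\<close>.  Since \<open>u\<close> lies on no wall, these \<open>I\<close> are the supports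
  of the faces of the simple polytope of all \<open>t \<ge> 0\<close> with \<open>\<Sum>i. t i *\<^sub>R \<Phi> i = u\<close>, and
  \<open>card I - r\<close> is the dimension of the face.  So the value is the Euler characteristic of
  this polytope with the facets \<open>t j = 0\<close>, \<open>j \<in> J\<close>, removed.

  If \<open>J\<close> is empty, it is \<open>1\<close> by Euler's relation.  This is \<open>alt_cone_sum_euler\<close>, an identity
  for every point \<open>u\<close> of the space, generic or not; this generality is what makes an induction
  on the number of generators possible.

  If \<open>J\<close> is not empty, the value is \<open>0\<close> provided that the removed facets are visible from a
  point of the affine space spanned by the polytope, that is, provided that \<open>u\<close> has
  coordinates \<open>y\<close> with \<open>y j \<le> 0\<close> for \<open>j \<in> J\<close> and \<open>y j \<ge> 0\<close> for the other \<open>j\<close>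
  (\<open>alt_cone_sum_eq_0\<close>).

  It remains to find, for each \<open>x\<close> over \<open>l\<close>, a point \<open>u\<close> of \<open>\<tau>\<close> with coordinates \<open>y\<close> of the
  same signs as those of \<open>x\<close> in this weak sense.  For \<open>l\<close> in the closure of \<open>\<tau>\<close>, add to \<open>x\<close> a small
  multiple of nonnegative coordinates of a point of \<open>\<tau>\<close>; the sum still lies over \<open>\<tau>\<close>
  (\<open>tope_closure_add\<close>).  For \<open>l = u - (\<Sum>i. t i *\<^sub>R \<Phi> i)\<close> with \<open>0 \<le> t i \<le> 1\<close> take
  \<open>y = x + t\<close>; for integral \<open>x\<close>, a negative coordinate is at most \<open>-1\<close>, so adding \<open>t i\<close> does
  not make it positive.
\<close>

section \<open>Cones and positive combinations\<close>

text \<open>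
  The relative interior of \<open>cone_gen \<Phi> I\<close>, in a form that is suited to induction on \<open>I\<close>.
\<close>
definition pos_cone :: "('n::finite \<Rightarrow> 'a::euclidean_space) \<Rightarrow> 'n set \<Rightarrow> 'a set" where
  "pos_cone \<Phi> I = {\<Sum>i\<in>I. t i *\<^sub>R \<Phi> i |t. \<forall>i\<in>I. 0 < t i}"

text \<open>
  This makes available that a finitely generated cone is closed.
\<close>
lemma cone_gen_eq_hull: "cone_gen \<Phi> I = convex_cone hull (\<Phi> ` I)"
proof (rule hull_unique[symmetric])
  show "\<Phi> ` I \<subseteq> cone_gen \<Phi> I"
  proof
    fix x assume "x \<in> \<Phi> ` I"
    then obtain i where i: "i \<in> I" "x = \<Phi> i" by auto
    have "(\<Sum>k\<in>I. of_bool (k = i) *\<^sub>R \<Phi> k) = (\<Sum>k\<in>{i}. \<Phi> k)"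
      using i by (intro sum.mono_neutral_cong_right) auto
    then show "x \<in> cone_gen \<Phi> I"
      unfolding cone_gen_def using i by (auto intro!: exI[of _ "\<lambda>k. of_bool (k = i)"])
  qed
  show "convex_cone (cone_gen \<Phi> I)"
    unfolding convex_cone_iff
  proof (intro conjI ballI allI impI)
    show "0 \<in> cone_gen \<Phi> I"
      unfolding cone_gen_def by (auto intro!: exI[of _ "\<lambda>_. 0"])
  next
    fix x y assume "x \<in> cone_gen \<Phi> I" "y \<in> cone_gen \<Phi> I"
    then obtain s t where st: "\<forall>i\<in>I. 0 \<le> s i" "\<forall>i\<in>I. 0 \<le> t i"
      "x = (\<Sum>i\<in>I. s i *\<^sub>R \<Phi> i)" "y = (\<Sum>i\<in>I. t i *\<^sub>R \<Phi> i)"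
      unfolding cone_gen_def by auto
    then show "x + y \<in> cone_gen \<Phi> I"
      unfolding cone_gen_def
      by (auto intro!: exI[of _ "\<lambda>i. s i + t i"] simp: scaleR_add_left sum.distrib)
  next
    fix x and c :: real assume "x \<in> cone_gen \<Phi> I" "0 \<le> c"
    then show "c *\<^sub>R x \<in> cone_gen \<Phi> I"
      unfolding cone_gen_def by (fastforce simp: scaleR_sum_right)
  qed
next
  fix C assume C: "\<Phi> ` I \<subseteq> C" "convex_cone C"
  show "cone_gen \<Phi> I \<subseteq> C"
  proof
    fix x assume "x \<in> cone_gen \<Phi> I"
    then obtain t where t: "\<forall>i\<in>I. 0 \<le> t i" "x = (\<Sum>i\<in>I. t i *\<^sub>R \<Phi> i)"
      unfolding cone_gen_def by auto
    have "(\<Sum>i\<in>K. t i *\<^sub>R \<Phi> i) \<in> C" if "K \<subseteq> I" for K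
      using finite[of K] that
    proof (induction K rule: finite_induct)
      case empty
      show ?case using C(2) by (simp add: convex_cone_contains_0)
    next
      case (insert k K)
      then show ?case
        using C t(1) by (auto intro!: convex_cone_add convex_cone_scaleR)
    qed
    then show "x \<in> C" using t(2) by auto
  qed
qed

lemma cone_gen_mono: "I \<subseteq> J \<Longrightarrow> cone_gen \<Phi> I \<subseteq> cone_gen \<Phi> J"
  unfolding cone_gen_eq_hull by (intro hull_mono image_mono)

lemma closed_cone_gen: "closed (cone_gen \<Phi> I)"
  unfolding cone_gen_eq_hull by (intro closed_convex_cone_hull) auto

lemma convex_cone_gen: "convex (cone_gen \<Phi> I)"
  unfolding cone_gen_eq_hull by (rule convex_convex_cone_hull)

lemma cone_gen_insert:
  assumes "j \<notin> I"
  shows "u \<in> cone_gen \<Phi> (insert j I) \<longleftrightarrow> (\<exists>s\<ge>0. u - s *\<^sub>R \<Phi> j \<in> cone_gen \<Phi> I)"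
proof
  assume "u \<in> cone_gen \<Phi> (insert j I)"
  then obtain t where "\<forall>i\<in>insert j I. 0 \<le> t i" "u = (\<Sum>i\<in>insert j I. t i *\<^sub>R \<Phi> i)"
    unfolding cone_gen_def by auto
  then show "\<exists>s\<ge>0. u - s *\<^sub>R \<Phi> j \<in> cone_gen \<Phi> I"
    using assms unfolding cone_gen_def by (auto intro!: exI[of _ "t j"] exI[of _ t])
next
  assume "\<exists>s\<ge>0. u - s *\<^sub>R \<Phi> j \<in> cone_gen \<Phi> I"
  then obtain s t where st: "s \<ge> 0" "\<forall>i\<in>I. 0 \<le> t i" "u - s *\<^sub>R \<Phi> j = (\<Sum>i\<in>I. t i *\<^sub>R \<Phi> i)"
    unfolding cone_gen_def by auto
  have "(\<Sum>i\<in>insert j I. (t(j := s)) i *\<^sub>R \<Phi> i) = s *\<^sub>R \<Phi> j + (\<Sum>i\<in>I. t i *\<^sub>R \<Phi> i)"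
    using assms by (subst sum.insert) (auto intro!: sum.cong)
  then have "u = (\<Sum>i\<in>insert j I. (t(j := s)) i *\<^sub>R \<Phi> i)"
    using st(3) by (simp add: algebra_simps)
  then show "u \<in> cone_gen \<Phi> (insert j I)"
    unfolding cone_gen_def using st by (intro CollectI exI[of _ "t(j := s)"]) auto
qed

lemma pos_cone_insert:
  assumes "j \<notin> I"
  shows "u \<in> pos_cone \<Phi> (insert j I) \<longleftrightarrow> (\<exists>s>0. u - s *\<^sub>R \<Phi> j \<in> pos_cone \<Phi> I)"
proof
  assume "u \<in> pos_cone \<Phi> (insert j I)"
  then obtain t where "\<forall>i\<in>insert j I. 0 < t i" "u = (\<Sum>i\<in>insert j I. t i *\<^sub>R \<Phi> i)"
    unfolding pos_cone_def by auto
  then show "\<exists>s>0. u - s *\<^sub>R \<Phi> j \<in> pos_cone \<Phi> I"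
    using assms unfolding pos_cone_def by (auto intro!: exI[of _ "t j"] exI[of _ t])
next
  assume "\<exists>s>0. u - s *\<^sub>R \<Phi> j \<in> pos_cone \<Phi> I"
  then obtain s t where st: "s > 0" "\<forall>i\<in>I. 0 < t i" "u - s *\<^sub>R \<Phi> j = (\<Sum>i\<in>I. t i *\<^sub>R \<Phi> i)"
    unfolding pos_cone_def by auto
  have "(\<Sum>i\<in>insert j I. (t(j := s)) i *\<^sub>R \<Phi> i) = s *\<^sub>R \<Phi> j + (\<Sum>i\<in>I. t i *\<^sub>R \<Phi> i)"
    using assms by (subst sum.insert) (auto intro!: sum.cong)
  then have "u = (\<Sum>i\<in>insert j I. (t(j := s)) i *\<^sub>R \<Phi> i)"
    using st(3) by (simp add: algebra_simps)
  then show "u \<in> pos_cone \<Phi> (insert j I)"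
    unfolding pos_cone_def using st by (intro CollectI exI[of _ "t(j := s)"]) auto
qed

lemma pos_cone_subset_cone_gen: "pos_cone \<Phi> I \<subseteq> cone_gen \<Phi> I"
  unfolding pos_cone_def cone_gen_def by (auto intro: less_imp_le)

lemma convex_pos_cone: "convex (pos_cone \<Phi> I)"
proof (rule convexI)
  fix x y and u v :: real
  assume xy: "x \<in> pos_cone \<Phi> I" "y \<in> pos_cone \<Phi> I" and uv: "0 \<le> u" "0 \<le> v" "u + v = 1"
  obtain s t where st: "\<forall>i\<in>I. 0 < s i" "\<forall>i\<in>I. 0 < t i"
      "x = (\<Sum>i\<in>I. s i *\<^sub>R \<Phi> i)" "y = (\<Sum>i\<in>I. t i *\<^sub>R \<Phi> i)"
    using xy unfolding pos_cone_def by auto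
  have pos: "0 < u * a + v * b" if "0 < a" "0 < b" for a b
    using that uv
    by (metis add.commute add_0 add_nonneg_pos add_pos_nonneg less_eq_real_def mult_nonneg_nonneg mult_pos_pos
        zero_neq_one)
  show "u *\<^sub>R x + v *\<^sub>R y \<in> pos_cone \<Phi> I"
    unfolding pos_cone_def using st pos
    by (auto intro!: exI[of _ "\<lambda>i. u * s i + v * t i"]
        simp: scaleR_add_left sum.distrib scaleR_sum_right)
qed

lemma in_span_image_iff:
  fixes \<Phi> :: "'n::finite \<Rightarrow> 'a::euclidean_space"
  shows "x \<in> span (\<Phi> ` I) \<longleftrightarrow> (\<exists>c. x = (\<Sum>i\<in>I. c i *\<^sub>R \<Phi> i))"
proof
  assume "x \<in> span (\<Phi> ` I)"
  then show "\<exists>c. x = (\<Sum>i\<in>I. c i *\<^sub>R \<Phi> i)"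
  proof (induction rule: span_induct_alt)
    case base
    show ?case by (auto intro!: exI[of _ "\<lambda>_. 0"])
  next
    case (step a b y)
    then obtain k c where k: "k \<in> I" "b = \<Phi> k" and c: "y = (\<Sum>i\<in>I. c i *\<^sub>R \<Phi> i)" by auto
    have "(\<Sum>i\<in>I. (a * of_bool (i = k)) *\<^sub>R \<Phi> i) = (\<Sum>i\<in>{k}. a *\<^sub>R \<Phi> i)"
      using k by (intro sum.mono_neutral_cong_right) auto
    then show ?case using k c
      by (intro exI[of _ "\<lambda>i. a * of_bool (i = k) + c i"])
        (simp add: scaleR_add_left sum.distrib del: scaleR_scaleR)
  qed
next
  assume "\<exists>c. x = (\<Sum>i\<in>I. c i *\<^sub>R \<Phi> i)"
  then show "x \<in> span (\<Phi> ` I)"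
    by (auto intro!: span_sum span_scale intro: span_base)
qed

lemma cone_gen_subset_span: "cone_gen \<Phi> I \<subseteq> span (\<Phi> ` I)"
  unfolding cone_gen_def by (auto simp: in_span_image_iff)

text \<open>
  Strictly positive coefficients absorb a small multiple of any other combination: this is
  the relative openness of the positive cone.
\<close>
lemma pos_cone_perturb:
  assumes "u \<in> pos_cone \<Phi> I" "v \<in> span (\<Phi> ` I)"
  obtains e where "e > 0" "\<And>d. \<bar>d\<bar> < e \<Longrightarrow> u + d *\<^sub>R v \<in> pos_cone \<Phi> I"
proof -
  obtain t where t: "\<forall>i\<in>I. 0 < t i" "u = (\<Sum>i\<in>I. t i *\<^sub>R \<Phi> i)"
    using assms(1) unfolding pos_cone_def by auto
  obtain c where c: "v = (\<Sum>i\<in>I. c i *\<^sub>R \<Phi> i)"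
    using assms(2) by (auto simp: in_span_image_iff)
  have "eventually (\<lambda>d. \<forall>i\<in>I. 0 < t i + d * c i) (nhds (0::real))"
  proof (rule eventually_ball_finite)
    show "\<forall>i\<in>I. eventually (\<lambda>d. 0 < t i + d * c i) (nhds (0::real))"
    proof
      fix i assume "i \<in> I"
      have "((\<lambda>d. t i + d * c i) \<longlongrightarrow> t i + 0 * c i) (nhds (0::real))"
        by (intro tendsto_intros filterlim_ident)
      then show "eventually (\<lambda>d. 0 < t i + d * c i) (nhds (0::real))"
        using t \<open>i \<in> I\<close> by (auto dest: order_tendstoD(1)[where a = 0])
    qed
  qed simp
  then obtain e where e: "e > 0" "\<And>d. dist d 0 < e \<Longrightarrow> \<forall>i\<in>I. 0 < t i + d * c i"
    unfolding eventually_nhds_metric by auto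
  show ?thesis
  proof (rule that[OF e(1)])
    fix d :: real assume "\<bar>d\<bar> < e"
    then show "u + d *\<^sub>R v \<in> pos_cone \<Phi> I"
      using e(2)[of d] t(2) c unfolding pos_cone_def
      by (auto intro!: exI[of _ "\<lambda>i. t i + d * c i"]
          simp: scaleR_add_left sum.distrib scaleR_sum_right)
  qed
qed

section \<open>Jumps of indicator functions on a half-line\<close>

text \<open>
  The Euler characteristic of a function on the open half-line that is a combination of indicators
  of bounded intervals is the sum of its jumps from the left.  The indicator of a closed interval
  jumps by \<open>1\<close> at its left end and nowhere else, since at its right end it is continuous from the left.
\<close>
lemma closed_convex_jump:
  fixes T :: "real set"
  assumes "closed T" "convex T" "T \<subseteq> {0..}" "e > 0"
  shows "eventually (\<lambda>s. of_bool (e \<in> T) - of_bool (s \<in> T)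
           = (of_bool (T \<noteq> {} \<and> Inf T = e) :: real)) (at_left e)"
proof (cases "e \<in> T")
  case True
  have bdd: "bdd_below T" using assms(3) by (meson atLeast_iff bdd_belowI subsetD)
  show ?thesis
  proof (cases "Inf T = e")
    case Inf: True
    have "s \<notin> T" if "s < e" for s
      using cInf_lower[OF _ bdd, of s] that Inf by auto
    then show ?thesis
      using True Inf eventually_at_left_real[of "e - 1" e] by (auto elim!: eventually_mono)
  next
    case False
    then have "Inf T < e" using cInf_lower[OF True bdd] by simp
    then obtain w where w: "w \<in> T" "w < e"
      using True by (metis cInf_lessD empty_iff)
    have "s \<in> T" if "s \<in> {w<..<e}" for s
      using assms(2) w True that unfolding is_interval_convex_1[symmetric] is_interval_1
      by (metis greaterThanLessThan_iff less_imp_le)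
    then show ?thesis
      using True False eventually_at_left_real[OF w(2)] by (auto elim: eventually_mono)
  qed
next
  case False
  have "eventually (\<lambda>s. s \<notin> T) (at_left e)"
  proof -
    have "open (- T)" using assms(1) by auto
    then have "eventually (\<lambda>s. s \<in> - T) (nhds e)"
      using False by (intro eventually_nhds_in_open) auto
    then show ?thesis by (auto simp: eventually_at_filter elim: eventually_mono)
  qed
  moreover have "\<not> (T \<noteq> {} \<and> Inf T = e)"
    using closed_contains_Inf[of T] assms(1,3) False by (meson atLeast_iff bdd_belowI subsetD)
  ultimately show ?thesis using False by (auto elim: eventually_mono)
qed

text \<open>
  For a combination \<open>g\<close> of indicators of closed intervals \<open>T i \<subseteq> {0..}\<close>, each interval
  that is nonempty and does not contain \<open>0\<close> has exactly one jump on the open half-line.  So the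
  sum of the coefficients of these intervals can be read off from the jumps \<open>D e\<close> of \<open>g\<close>, without
  knowing the single intervals.
\<close>
lemma sum_of_left_jumps:
  fixes T :: "'i \<Rightarrow> real set" and c :: "'i \<Rightarrow> real"
  assumes A: "finite A" and T: "\<And>i. i \<in> A \<Longrightarrow> closed (T i) \<and> convex (T i) \<and> T i \<subseteq> {0..}"
    and E: "finite E" "E \<subseteq> {0<..}"
      "\<And>i. i \<in> A \<Longrightarrow> T i \<noteq> {} \<Longrightarrow> 0 \<notin> T i \<Longrightarrow> Inf (T i) \<in> E"
    and g: "\<And>s. s > 0 \<Longrightarrow> (\<Sum>i\<in>A. c i * of_bool (s \<in> T i)) = g s"
    and D: "\<And>e. e \<in> E \<Longrightarrow> eventually (\<lambda>s. g e - g s = D e) (at_left e)"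
  shows "(\<Sum>i\<in>A. c i * of_bool (T i \<noteq> {} \<and> 0 \<notin> T i)) = (\<Sum>e\<in>E. D e)"
proof -
  have "D e = (\<Sum>i\<in>A. c i * of_bool (T i \<noteq> {} \<and> Inf (T i) = e))" if "e \<in> E" for e
  proof -
    have e: "e > 0" using E(2) that by auto
    have "eventually (\<lambda>s. \<forall>i\<in>A. of_bool (e \<in> T i) - of_bool (s \<in> T i)
           = (of_bool (T i \<noteq> {} \<and> Inf (T i) = e) :: real)) (at_left e)"
      using A T e by (intro eventually_ball_finite ballI closed_convex_jump) auto
    then have "eventually (\<lambda>s. D e = (\<Sum>i\<in>A. c i * of_bool (T i \<noteq> {} \<and> Inf (T i) = e))) (at_left e)"
      using D[OF that] eventually_at_left_real[OF e]
    proof eventually_elim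
      case (elim s)
      have "D e = (\<Sum>i\<in>A. c i * of_bool (e \<in> T i)) - (\<Sum>i\<in>A. c i * of_bool (s \<in> T i))"
        using elim e g[of e] g[of s] by simp
      also have "\<dots> = (\<Sum>i\<in>A. c i * (of_bool (e \<in> T i) - of_bool (s \<in> T i)))"
        by (simp add: sum_subtractf right_diff_distrib)
      also have "\<dots> = (\<Sum>i\<in>A. c i * of_bool (T i \<noteq> {} \<and> Inf (T i) = e))"
        using elim by (intro sum.cong) auto
      finally show ?case .
    qed
    then show ?thesis by (simp add: eventually_const_iff)
  qed
  then have "(\<Sum>e\<in>E. D e) = (\<Sum>i\<in>A. \<Sum>e\<in>E. c i * of_bool (T i \<noteq> {} \<and> Inf (T i) = e))"
    by (simp add: sum.swap[of _ E])
  also have "\<dots> = (\<Sum>i\<in>A. c i * of_bool (T i \<noteq> {} \<and> 0 \<notin> T i))"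
  proof (rule sum.cong)
    fix i assume i: "i \<in> A"
    have bdd: "bdd_below (T i)" using T[OF i] by (auto intro!: bdd_belowI[of _ 0])
    have "T i \<noteq> {} \<and> Inf (T i) \<in> E \<longleftrightarrow> T i \<noteq> {} \<and> 0 \<notin> T i"
    proof -
      have "Inf (T i) \<le> 0" if "0 \<in> T i" using cInf_lower[OF that bdd] .
      then show ?thesis using E(3)[OF i] E(2) by force
    qed
    moreover have "(\<Sum>e\<in>E. c i * of_bool (T i \<noteq> {} \<and> Inf (T i) = e))
        = c i * of_bool (T i \<noteq> {} \<and> Inf (T i) \<in> E)"
      by (cases "Inf (T i) \<in> E"; cases "T i = {}")
        (auto simp: E(1) sum_distrib_left[symmetric] of_bool_def sum.delta)
    ultimately show "(\<Sum>e\<in>E. c i * of_bool (T i \<noteq> {} \<and> Inf (T i) = e))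
        = c i * of_bool (T i \<noteq> {} \<and> 0 \<notin> T i)" by simp
  qed simp
  finally show ?thesis ..
qed

text \<open>
  An open interval jumps in the opposite way: its indicator is continuous from the left at
  the left end and drops by \<open>1\<close> at the right end.  The opposite signs of the jumps of closed and of
  open intervals are the source of the sign change between a cone and its interior in Euler's relation.
\<close>
lemma open_convex_jump:
  fixes W :: "real set"
  assumes "open W" "convex W" "bdd_above W" "W \<noteq> {}"
  shows "eventually (\<lambda>s. of_bool (e \<in> W) - of_bool (s \<in> W) = (- of_bool (e = Sup W) :: real)) (at_left e)"
proof -
  have int: "b \<in> W" if "a \<in> W" "c \<in> W" "a \<le> b" "b \<le> c" for a b c
    using assms(2) that unfolding is_interval_convex_1[symmetric] is_interval_1 by blast
  consider "e \<in> W" | "e \<notin> W" "e < Sup W" | "e = Sup W" "e \<notin> W" | "Sup W < e" "e \<notin> W"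
    by fastforce
  then show ?thesis
  proof cases
    case 1
    obtain d where d: "d > 0" "\<And>y. dist y e < d \<Longrightarrow> y \<in> W"
      using assms(1) 1 unfolding open_dist by blast
    have "e + d / 2 \<le> Sup W"
      using d by (intro cSup_upper assms) (auto simp: dist_real_def)
    then have "e \<noteq> Sup W" using d(1) by auto
    moreover have "s \<in> W" if "s \<in> {e - d<..<e}" for s
      using that d(2)[of s] by (auto simp: dist_real_def)
    ultimately show ?thesis
      using 1 d(1) eventually_at_left_real[of "e - d" e] by (auto elim!: eventually_mono)
  next
    case 2
    then obtain w where w: "w \<in> W" "e < w" using less_cSup_iff[OF assms(4,3)] by auto
    have "s \<notin> W" if "s \<in> {e - 1<..<e}" for s
      using int[of s w e] that w 2 by auto
    then show ?thesis
      using 2 eventually_at_left_real[of "e - 1" e] by (auto elim!: eventually_mono)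
  next
    case 3
    obtain w where w: "w \<in> W" using assms(4) by auto
    then have "w < e" using cSup_upper[OF w assms(3)] 3 by (metis order_le_less)
    have "s \<in> W" if s: "s \<in> {w<..<e}" for s
    proof -
      obtain w' where "w' \<in> W" "s < w'"
        using less_cSup_iff[OF assms(4,3), of s] 3 s by auto
      then show ?thesis using int[of w w' s] w s by auto
    qed
    then show ?thesis
      using 3 eventually_at_left_real[OF \<open>w < e\<close>] by (auto elim!: eventually_mono)
  next
    case 4
    have "s \<notin> W" if s: "s \<in> {Sup W<..<e}" for s
      using cSup_upper[OF _ assms(3), of s] s by auto
    then show ?thesis
      using 4 eventually_at_left_real[OF 4(1)] by (auto elim!: eventually_mono)
  qed
qed

section \<open>Euler's relation for representations by a pointed family\<close>

text \<open>
  Up to the factor \<open>(-1) ^ DIM('a)\<close> this is, for generic \<open>u\<close> and a pointed family, the Euler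
  characteristic of the polytope of nonnegative representations of \<open>u\<close> by the \<open>\<Phi> i\<close> with \<open>i \<in> M\<close>, after removal of its
  facets \<open>t j = 0\<close> for \<open>j \<in> J\<close>.
\<close>
definition alt_cone_sum ::
    "('n::finite \<Rightarrow> 'a::euclidean_space) \<Rightarrow> 'n set \<Rightarrow> 'n set \<Rightarrow> 'a \<Rightarrow> real" where
  "alt_cone_sum \<Phi> J M u =
     (\<Sum>I | J \<subseteq> I \<and> I \<subseteq> M. (-1) ^ card I * of_bool (u \<in> cone_gen \<Phi> I))"

text \<open>
  Removing the facet \<open>t j = 0\<close> subtracts its Euler characteristic; the facet is the polytope of
  the family without \<open>j\<close>.
\<close>
lemma alt_cone_sum_split:
  assumes "j \<in> J"
  shows "alt_cone_sum \<Phi> J M u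
    = alt_cone_sum \<Phi> (J - {j}) M u - alt_cone_sum \<Phi> (J - {j}) (M - {j}) u"
proof -
  have "{I. J - {j} \<subseteq> I \<and> I \<subseteq> M}
      = {I. J \<subseteq> I \<and> I \<subseteq> M} \<union> {I. J - {j} \<subseteq> I \<and> I \<subseteq> M - {j}}"
    using assms by auto
  moreover have "{I. J \<subseteq> I \<and> I \<subseteq> M} \<inter> {I. J - {j} \<subseteq> I \<and> I \<subseteq> M - {j}} = {}"
    using assms by auto
  ultimately show ?thesis
    unfolding alt_cone_sum_def by (simp add: sum.union_disjoint del: sum_mult_of_bool_eq)
qed

lemma alt_cone_sum_insert:
  assumes "j \<notin> M"
  shows "alt_cone_sum \<Phi> {} (insert j M) u = alt_cone_sum \<Phi> {} M u
    - (\<Sum>I\<in>Pow M. (-1) ^ card I * of_bool (u \<in> cone_gen \<Phi> (insert j I)))"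
proof -
  have *: "{I. {} \<subseteq> I \<and> I \<subseteq> N} = Pow N" for N :: "'a set" by auto
  have inj: "inj_on (insert j) (Pow M)"
    using assms by (auto simp: inj_on_def)
  have dis: "Pow M \<inter> insert j ` Pow M = {}" using assms by auto
  have "(\<Sum>I\<in>insert j ` Pow M. (-1) ^ card I * of_bool (u \<in> cone_gen \<Phi> I))
      = (\<Sum>I\<in>Pow M. - ((-1) ^ card I * of_bool (u \<in> cone_gen \<Phi> (insert j I)) :: real))"
  proof (subst sum.reindex[OF inj], rule sum.cong)
    fix I assume "I \<in> Pow M"
    then have "j \<notin> I" using assms by auto
    then show "((\<lambda>I. (-1) ^ card I * of_bool (u \<in> cone_gen \<Phi> I)) \<circ> insert j) I
      = - ((-1) ^ card I * of_bool (u \<in> cone_gen \<Phi> (insert j I)) :: real)"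
      by (simp add: card_insert_disjoint)
  qed simp
  then show ?thesis
    unfolding alt_cone_sum_def * Pow_insert using dis
    by (simp add: sum.union_disjoint sum_negf del: sum_mult_of_bool_eq)
qed

lemma convex_line_preimage:
  fixes u v :: "'a::real_vector"
  assumes "convex C"
  shows "convex {s::real. u - s *\<^sub>R v \<in> C}"
proof (rule convexI)
  fix x y a b :: real
  assume xy: "x \<in> {s. u - s *\<^sub>R v \<in> C}" "y \<in> {s. u - s *\<^sub>R v \<in> C}"
    and ab: "0 \<le> a" "0 \<le> b" "a + b = 1"
  have "u - (a * x + b * y) *\<^sub>R v = (a + b) *\<^sub>R u - (a * x + b * y) *\<^sub>R v"
    using ab by simp
  also have "\<dots> = a *\<^sub>R (u - x *\<^sub>R v) + b *\<^sub>R (u - y *\<^sub>R v)"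
    by (simp add: algebra_simps)
  also have "\<dots> \<in> C" using xy ab by (intro convexD[OF assms]) auto
  finally show "a *\<^sub>R x + b *\<^sub>R y \<in> {s. u - s *\<^sub>R v \<in> C}" by simp
qed

lemma closed_line_preimage:
  fixes u v :: "'a::real_normed_vector"
  assumes "closed C"
  shows "closed {s::real. u - s *\<^sub>R v \<in> C}"
proof -
  have "continuous_on UNIV (\<lambda>s::real. u - s *\<^sub>R v)" by (intro continuous_intros)
  from closed_vimage[OF assms this] show ?thesis by (simp add: vimage_def)
qed

text \<open>
  If the points \<open>u - s *\<^sub>R v\<close> lay in the cone for arbitrarily large \<open>s\<close>, then the limit
  \<open>- v\<close> of \<open>u /\<^sub>R s - v\<close> would belong to the cone, which is closed.
\<close>
lemma bdd_above_line_in_cone: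
  assumes "- v \<notin> cone_gen \<Phi> M"
  shows "bdd_above {s. u - s *\<^sub>R v \<in> cone_gen \<Phi> M}"
proof (rule ccontr)
  assume "\<not> ?thesis"
  then have "\<forall>n. \<exists>s. s > real (Suc n) \<and> u - s *\<^sub>R v \<in> cone_gen \<Phi> M"
    unfolding bdd_above_def by (metis mem_Collect_eq not_le)
  then obtain s where s: "\<And>n. s n > real (Suc n)" "\<And>n. u - s n *\<^sub>R v \<in> cone_gen \<Phi> M"
    by metis
  have lim: "(\<lambda>n. inverse (s n)) \<longlonglongrightarrow> 0"
  proof (rule tendsto_sandwich[OF _ _ tendsto_const LIMSEQ_inverse_real_of_nat])
    show "eventually (\<lambda>n. 0 \<le> inverse (s n)) sequentially"
      using s(1) by (intro always_eventually) (meson inverse_nonnegative_iff_nonnegative le_less_trans less_imp_le of_nat_0_le_iff)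
    show "eventually (\<lambda>n. inverse (s n) \<le> inverse (real (Suc n))) sequentially"
      using s(1) by (intro always_eventually allI le_imp_inverse_le) (auto intro: less_imp_le)
  qed
  have "(\<lambda>n. inverse (s n) *\<^sub>R u - v) \<longlonglongrightarrow> 0 *\<^sub>R u - v"
    by (intro tendsto_intros lim)
  moreover have "inverse (s n) *\<^sub>R u - v \<in> cone_gen \<Phi> M" for n
  proof -
    have pos: "s n > 0" using s(1)[of n] by (meson less_trans of_nat_0_less_iff zero_less_Suc)
    have "inverse (s n) *\<^sub>R (u - s n *\<^sub>R v) \<in> cone_gen \<Phi> M"
      using s(2)[of n] pos unfolding cone_gen_eq_hull by (intro convex_cone_hull_mul) auto
    then show ?thesis using pos by (simp add: scaleR_diff_right)
  qed
  ultimately have "0 *\<^sub>R u - v \<in> cone_gen \<Phi> M"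
    using closed_sequentially[OF closed_cone_gen[of \<Phi> M], of "\<lambda>n. inverse (s n) *\<^sub>R u - v"]
    by blast
  then show False using assms by simp
qed

text \<open>
  Euler's relation: the alternating sum of the indicators of all cones generated by subfamilies is,
  up to sign, the indicator of the relative interior of the whole cone.

  The proof adds one generator \<open>\<Phi> j\<close> to \<open>M\<close>.  The sets containing \<open>j\<close> and the sets
  without \<open>j\<close> pair up, and only the pairs with \<open>u\<close> in the cone of \<open>insert j I\<close> but not in the cone
  of \<open>I\<close> survive.  In terms of \<open>T I\<close>, the set of all \<open>s \<ge> 0\<close> with \<open>u - s *\<^sub>R \<Phi> j\<close> in the
  cone of \<open>I\<close>, these are the \<open>I\<close> for which \<open>T I\<close> is nonempty and omits \<open>0\<close>.  By induction the
  alternating sum of the indicators of the closed intervals \<open>T I\<close> is, up to sign, the indicator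
  of the set \<open>W\<close> of those \<open>s > 0\<close> for which \<open>u - s *\<^sub>R \<Phi> j\<close> is a positive combination over \<open>M\<close>,
  and \<open>sum_of_left_jumps\<close> applies.  If \<open>\<Phi> j\<close> lies in the span of \<open>M\<close>, then \<open>W\<close> is an open interval,
  bounded because the cone is pointed, with jump \<open>-1\<close>, and the dimension stays the same; otherwise \<open>W\<close>
  has at most one point, with jump \<open>1\<close>, and the dimension grows by one.  In both cases \<open>W\<close> is nonempty
  exactly if \<open>u\<close> is a positive combination over \<open>insert j M\<close>.
\<close>
lemma alt_cone_sum_euler:
  fixes \<Phi> :: "'n::finite \<Rightarrow> 'a::euclidean_space"
  assumes pointed: "\<And>j. - \<Phi> j \<notin> cone_gen \<Phi> UNIV"
  shows "alt_cone_sum \<Phi> {} M u = (-1) ^ dim (\<Phi> ` M) * of_bool (u \<in> pos_cone \<Phi> M)"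
  using finite[of M]
proof (induction M arbitrary: u rule: finite_induct)
  case empty
  have "{I :: 'n set. {} \<subseteq> I \<and> I \<subseteq> {}} = {{}}" by auto
  then show ?case by (simp add: alt_cone_sum_def cone_gen_def pos_cone_def)
next
  case (insert j M)
  define T where "T I = {s. 0 \<le> s \<and> u - s *\<^sub>R \<Phi> j \<in> cone_gen \<Phi> I}" for I
  define W where "W = {s. 0 < s \<and> u - s *\<^sub>R \<Phi> j \<in> pos_cone \<Phi> M}"
  define c :: "'n set \<Rightarrow> real" where "c I = (-1) ^ card I" for I
  define \<epsilon> :: real where "\<epsilon> = (-1) ^ dim (\<Phi> ` M)"
  define S where "S = (\<Sum>I\<in>Pow M. c I * of_bool (T I \<noteq> {} \<and> 0 \<notin> T I))"
  define E where "E = {Inf (T I) |I. I \<in> Pow M \<and> T I \<noteq> {} \<and> 0 \<notin> T I}"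
  have T: "closed (T I) \<and> convex (T I) \<and> T I \<subseteq> {0..}" for I
  proof -
    have "T I = {0..} \<inter> {s. u - s *\<^sub>R \<Phi> j \<in> cone_gen \<Phi> I}" unfolding T_def by auto
    then show ?thesis
      by (auto intro!: closed_Int convex_Int closed_line_preimage convex_line_preimage
          closed_cone_gen convex_cone_gen simp: convex_real_interval)
  qed
  have E: "finite E" "E \<subseteq> {0<..}" 
    "\<And>I. I \<in> Pow M \<Longrightarrow> T I \<noteq> {} \<Longrightarrow> 0 \<notin> T I \<Longrightarrow> Inf (T I) \<in> E"
  proof -
    show "finite E" unfolding E_def by auto
    show "E \<subseteq> {0<..}"
    proof
      fix e assume "e \<in> E"
      then obtain I where I: "e = Inf (T I)" "T I \<noteq> {}" "0 \<notin> T I" unfolding E_def by auto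
      have "Inf (T I) \<in> T I"
        using T[of I] I by (intro closed_contains_Inf) (auto intro!: bdd_belowI[of _ 0])
      then show "e \<in> {0<..}" using I T[of I] by (metis atLeast_iff greaterThan_iff order_le_less subsetD)
    qed
  qed (auto simp: E_def)
  have g: "(\<Sum>I\<in>Pow M. c I * of_bool (s \<in> T I)) = \<epsilon> * of_bool (s \<in> W)" if "s > 0" for s
  proof -
    have "{I. {} \<subseteq> I \<and> I \<subseteq> M} = Pow M" by auto
    then have "(\<Sum>I\<in>Pow M. c I * of_bool (s \<in> T I)) = alt_cone_sum \<Phi> {} M (u - s *\<^sub>R \<Phi> j)"
      unfolding alt_cone_sum_def T_def c_def using that by (intro sum.cong) auto
    then show ?thesis
      using insert.IH[of "u - s *\<^sub>R \<Phi> j"] that unfolding W_def \<epsilon>_def by simp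
  qed
  \<comment> \<open>The set of possible jumps is enlarged by a point \<open>w\<close>, so that it is known to contain the
    jump of the indicator of \<open>W\<close>.\<close>
  have jumps: "S = (\<Sum>e\<in>insert w E. D e)"
    if "w > 0" "\<And>e. e > 0 \<Longrightarrow> eventually (\<lambda>s. \<epsilon> * of_bool (e \<in> W) - \<epsilon> * of_bool (s \<in> W) = D e) (at_left e)"
    for w D
    unfolding S_def using T E that g by (intro sum_of_left_jumps) auto
  have delta: "(\<Sum>e\<in>insert w E. a * of_bool (e = w)) = a" for w a :: real
  proof -
    have "(\<Sum>e\<in>insert w E. a * of_bool (e = w)) = (\<Sum>e\<in>{w}. a)"
      using E(1) by (intro sum.mono_neutral_cong_right) auto
    then show ?thesis by simp
  qed
  have S: "S = - ((-1) ^ dim (\<Phi> ` insert j M) * of_bool (W \<noteq> {}))"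
  proof (cases "W = {}")
    case True
    then show ?thesis using jumps[of 1 "\<lambda>_. 0"] by simp
  next
    case False
    then obtain w where w: "w \<in> W" by auto
    then have w0: "w > 0" unfolding W_def by auto
    show ?thesis
    proof (cases "\<Phi> j \<in> span (\<Phi> ` M)")
      case True
      have "open W"
        unfolding open_dist
      proof
        fix s assume s: "s \<in> W"
        then obtain e where e: "e > 0"
          "\<And>d. \<bar>d\<bar> < e \<Longrightarrow> (u - s *\<^sub>R \<Phi> j) + d *\<^sub>R \<Phi> j \<in> pos_cone \<Phi> M"
          using pos_cone_perturb[OF _ True] unfolding W_def by blast
        show "\<exists>e>0. \<forall>y. dist y s < e \<longrightarrow> y \<in> W"
        proof (intro exI[of _ "min e s"] conjI allI impI)
          show "min e s > 0" using e s unfolding W_def by auto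
          fix y assume "dist y s < min e s"
          then show "y \<in> W"
            using e(2)[of "s - y"] s unfolding W_def by (auto simp: dist_real_def algebra_simps)
        qed
      qed
      moreover have "convex W"
      proof -
        have "W = {0<..} \<inter> {s. u - s *\<^sub>R \<Phi> j \<in> pos_cone \<Phi> M}" unfolding W_def by auto
        then show ?thesis
          by (auto intro!: convex_Int convex_line_preimage convex_pos_cone simp: convex_real_interval)
      qed
      moreover have bdd: "bdd_above W"
      proof (rule bdd_above_mono[OF bdd_above_line_in_cone[of "\<Phi> j" \<Phi> M u]])
        show "- \<Phi> j \<notin> cone_gen \<Phi> M" using pointed[of j] cone_gen_mono[of M UNIV \<Phi>] by auto
        show "W \<subseteq> {s. u - s *\<^sub>R \<Phi> j \<in> cone_gen \<Phi> M}"
          using pos_cone_subset_cone_gen unfolding W_def by auto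
      qed
      ultimately have jmp: "eventually (\<lambda>s. of_bool (e \<in> W) - of_bool (s \<in> W) = (- of_bool (e = Sup W) :: real)) (at_left e)" for e
        using False by (intro open_convex_jump) auto
      have "S = (\<Sum>e\<in>insert (Sup W) E. (- \<epsilon>) * of_bool (e = Sup W))"
      proof (rule jumps)
        show "Sup W > 0" using cSup_upper[OF w bdd] w0 by simp
        show "eventually (\<lambda>s. \<epsilon> * of_bool (e \<in> W) - \<epsilon> * of_bool (s \<in> W) = - \<epsilon> * of_bool (e = Sup W)) (at_left e)" for e
          using jmp[of e]
        proof eventually_elim
          case (elim s)
          then show ?case by (metis minus_mult_commute right_diff_distrib)
        qed
      qed
      then have "S = - \<epsilon>" unfolding delta .
      then show ?thesis using False True unfolding \<epsilon>_def by (simp add: dim_insert)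
    next
      case nspan: False
      have W: "W = {w}"
      proof -
        have "s = w" if "s \<in> W" for s
        proof (rule ccontr)
          assume "s \<noteq> w"
          have "u - x *\<^sub>R \<Phi> j \<in> span (\<Phi> ` M)" if "x \<in> W" for x
            using that pos_cone_subset_cone_gen cone_gen_subset_span unfolding W_def by blast
          then have "(u - s *\<^sub>R \<Phi> j) - (u - w *\<^sub>R \<Phi> j) \<in> span (\<Phi> ` M)"
            using that w span_diff by blast
          then have "(w - s) *\<^sub>R \<Phi> j \<in> span (\<Phi> ` M)" by (simp add: algebra_simps)
          then have "inverse (w - s) *\<^sub>R (w - s) *\<^sub>R \<Phi> j \<in> span (\<Phi> ` M)" by (rule span_scale)
          then show False using nspan \<open>s \<noteq> w\<close> by simp
        qed
        then show ?thesis using w by blast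
      qed
      have "S = (\<Sum>e\<in>insert w E. \<epsilon> * of_bool (e = w))"
      proof (rule jumps[OF w0])
        fix e :: real
        have "eventually (\<lambda>s. s \<noteq> w) (at_left e)" by (rule eventually_neq_at_within)
        then show "eventually (\<lambda>s. \<epsilon> * of_bool (e \<in> W) - \<epsilon> * of_bool (s \<in> W) = \<epsilon> * of_bool (e = w)) (at_left e)"
          by eventually_elim (simp add: W)
      qed
      then have "S = \<epsilon>" unfolding delta .
      then show ?thesis using False nspan unfolding \<epsilon>_def by (simp add: dim_insert)
    qed
  qed
  have "alt_cone_sum \<Phi> {} (insert j M) u = - S"
  proof -
    have "{I. {} \<subseteq> I \<and> I \<subseteq> M} = Pow M" by auto
    then have M: "alt_cone_sum \<Phi> {} M u = (\<Sum>I\<in>Pow M. c I * of_bool (u \<in> cone_gen \<Phi> I))"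
      unfolding alt_cone_sum_def c_def by simp
    have "of_bool (u \<in> cone_gen \<Phi> (insert j I)) - of_bool (u \<in> cone_gen \<Phi> I)
        = (of_bool (T I \<noteq> {} \<and> 0 \<notin> T I) :: real)" if "I \<in> Pow M" for I
    proof -
      have "j \<notin> I" using that insert.hyps by auto
      from cone_gen_insert[OF this, of u \<Phi>] have "u \<in> cone_gen \<Phi> (insert j I) \<longleftrightarrow> T I \<noteq> {}"
        unfolding T_def by auto
      moreover have "u \<in> cone_gen \<Phi> I \<longleftrightarrow> 0 \<in> T I" unfolding T_def by simp
      ultimately show ?thesis by auto
    qed
    then have "S = (\<Sum>I\<in>Pow M. c I * (of_bool (u \<in> cone_gen \<Phi> (insert j I)) - of_bool (u \<in> cone_gen \<Phi> I)))"
      unfolding S_def by (intro sum.cong) auto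
    then show ?thesis
      unfolding alt_cone_sum_insert[OF insert.hyps(2)] M c_def
      by (simp add: right_diff_distrib sum_subtractf del: sum_mult_of_bool_eq)
  qed
  moreover have "u \<in> pos_cone \<Phi> (insert j M) \<longleftrightarrow> W \<noteq> {}"
    unfolding pos_cone_insert[OF insert.hyps(2)] W_def by auto
  ultimately show ?case using S by simp
qed

section \<open>Points on no wall\<close>

text \<open>
  The generators with a positive coefficient in a representation of \<open>u\<close> span the whole space:
  otherwise a basis of their span, completed to a basis chosen from \<open>\<Phi>\<close>, would put \<open>u\<close> on a wall.  The
  remaining generators can then be given a small positive coefficient as well.
\<close>
lemma generic_in_cone:
  fixes \<Phi> :: "'n::finite \<Rightarrow> 'a::euclidean_space"
  assumes spn: "span (range \<Phi>) = UNIV" and generic: "u \<notin> \<Union>(walls \<Phi>)"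
    and u: "u \<in> cone_gen \<Phi> M"
  shows "span (\<Phi> ` M) = UNIV" "u \<in> pos_cone \<Phi> M"
proof -
  obtain t where t: "\<forall>i\<in>M. 0 \<le> t i" "u = (\<Sum>i\<in>M. t i *\<^sub>R \<Phi> i)"
    using u unfolding cone_gen_def by auto
  define P where "P = {i \<in> M. t i > 0}"
  have uP: "u = (\<Sum>i\<in>P. t i *\<^sub>R \<Phi> i)"
    unfolding t(2) P_def using t(1) by (intro sum.mono_neutral_right) force+
  then have posP: "u \<in> pos_cone \<Phi> P" unfolding pos_cone_def P_def by auto
  have spanP: "span (\<Phi> ` P) = UNIV"
  proof (rule ccontr)
    assume ns: "span (\<Phi> ` P) \<noteq> UNIV"
    obtain B where B: "B \<subseteq> \<Phi> ` P" "independent B" "\<Phi> ` P \<subseteq> span B"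
      using maximal_independent_subset[of "\<Phi> ` P"] by metis
    obtain B' where B': "B \<subseteq> B'" "B' \<subseteq> range \<Phi>" "independent B'" "range \<Phi> \<subseteq> span B'"
      using maximal_independent_subset_extend[of B "range \<Phi>"] B by blast
    have "span B' = UNIV"
      using B'(4) spn by (metis span_mono span_span top.extremum_uniqueI)
    then have cardB': "card B' = DIM('a)"
      using B'(3) by (metis dim_UNIV dim_eq_card_independent dim_span)
    have spB: "span B = span (\<Phi> ` P)"
      using B by (metis span_mono span_span subset_antisym)
    have finB': "finite B'" using finite_subset[OF B'(2)] by simp
    have "B \<noteq> B'" using spB ns \<open>span B' = UNIV\<close> by auto
    \<comment> \<open>Dropping one vector from \<open>B'\<close> that is not in \<open>B\<close> leaves \<open>r - 1\<close> vectors, whose span contains \<open>u\<close>.\<close>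
    then obtain b where b: "b \<in> B'" "b \<notin> B" using B'(1) by blast
    have "span (B' - {b}) \<in> walls \<Phi>"
      unfolding walls_def using B' b cardB' finB'
      by (intro CollectI exI[of _ "B' - {b}"] conjI independent_mono[of B' "B' - {b}"]) auto
    moreover have "u \<in> span (B' - {b})"
    proof -
      have "u \<in> span B" unfolding spB using uP by (auto simp: in_span_image_iff)
      moreover have "B \<subseteq> B' - {b}" using B'(1) b by auto
      ultimately show ?thesis using span_mono by blast
    qed
    ultimately show False using generic by auto
  qed
  have "P \<subseteq> M" unfolding P_def by auto
  then show "span (\<Phi> ` M) = UNIV"
    using spanP by (metis image_mono span_mono top.extremum_uniqueI)
  define v where "v = (\<Sum>i\<in>M - P. \<Phi> i)"
  obtain e where e: "e > 0" "\<And>d. \<bar>d\<bar> < e \<Longrightarrow> u + d *\<^sub>R v \<in> pos_cone \<Phi> P"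
    using pos_cone_perturb[OF posP, of v] spanP by auto
  obtain s where s: "\<forall>i\<in>P. 0 < s i" "u + (- (e / 2)) *\<^sub>R v = (\<Sum>i\<in>P. s i *\<^sub>R \<Phi> i)"
    using e(1) e(2)[of "- (e / 2)"] unfolding pos_cone_def by auto
  have "(\<Sum>i\<in>M. (if i \<in> P then s i else e / 2) *\<^sub>R \<Phi> i)
      = (\<Sum>i\<in>M - P. (e / 2) *\<^sub>R \<Phi> i) + (\<Sum>i\<in>P. s i *\<^sub>R \<Phi> i)"
    by (subst sum.subset_diff[OF \<open>P \<subseteq> M\<close>]) auto
  also have "(\<Sum>i\<in>M - P. (e / 2) *\<^sub>R \<Phi> i) = (e / 2) *\<^sub>R v"
    unfolding v_def scaleR_sum_right ..
  also have "(\<Sum>i\<in>P. s i *\<^sub>R \<Phi> i) = u + (- (e / 2)) *\<^sub>R v" using s(2) ..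
  also have "(e / 2) *\<^sub>R v + (u + (- (e / 2)) *\<^sub>R v) = u" by simp
  finally show "u \<in> pos_cone \<Phi> M"
    unfolding pos_cone_def using s(1) e(1)
    by (intro CollectI exI[of _ "\<lambda>i. if i \<in> P then s i else e / 2"]) auto
qed

lemma alt_cone_sum_generic:
  fixes \<Phi> :: "'n::finite \<Rightarrow> 'a::euclidean_space"
  assumes "\<And>j. - \<Phi> j \<notin> cone_gen \<Phi> UNIV" "span (range \<Phi>) = UNIV" "u \<notin> \<Union>(walls \<Phi>)"
    and "u \<in> cone_gen \<Phi> M"
  shows "alt_cone_sum \<Phi> {} M u = (-1) ^ DIM('a)"
proof -
  have "dim (\<Phi> ` M) = DIM('a)"
    using generic_in_cone(1)[OF assms(2-4)] by (simp add: dim_eq_full)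
  then show ?thesis
    using alt_cone_sum_euler[OF assms(1), of M u] generic_in_cone(2)[OF assms(2-4)] by simp
qed

text \<open>
  If all removed facets are visible from \<open>y\<close>, the Euler characteristic vanishes.  Move from \<open>y\<close> on
  a straight line to a point \<open>p\<close> of the polytope, and stop at the first point \<open>z\<close> where one of the
  coordinates in \<open>J\<close>, say the one of \<open>j\<close>, becomes zero.  All signs of \<open>z\<close> are still as required, so
  by induction the sum for \<open>J - {j}\<close> vanishes both for the family \<open>M\<close> and, since \<open>z j = 0\<close>, for
  \<open>M - {j}\<close>; the sum for \<open>J\<close> is their difference.  At the last step \<open>J - {j}\<close> is empty; then
  \<open>z\<close> is itself in the polytope, and both sums have the same value \<open>(-1) ^ r\<close> by Euler's relation.
\<close>
lemma alt_cone_sum_eq_0: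
  fixes \<Phi> :: "'n::finite \<Rightarrow> 'a::euclidean_space"
  assumes "\<And>j. - \<Phi> j \<notin> cone_gen \<Phi> UNIV" "span (range \<Phi>) = UNIV" "u \<notin> \<Union>(walls \<Phi>)"
    and "J \<noteq> {}" "J \<subseteq> M"
    and "u = (\<Sum>i\<in>M. y i *\<^sub>R \<Phi> i)" "\<And>i. i \<in> J \<Longrightarrow> y i \<le> 0" "\<And>i. i \<in> M - J \<Longrightarrow> 0 \<le> y i"
  shows "alt_cone_sum \<Phi> J M u = 0"
  using finite[of J] assms(4-)
proof (induction J arbitrary: M y rule: finite_psubset_induct)
  case (psubset J)
  show ?case
  proof (cases "u \<in> cone_gen \<Phi> M")
    case False
    then have "u \<notin> cone_gen \<Phi> I" if "I \<subseteq> M" for I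
      using cone_gen_mono[OF that] by auto
    then show ?thesis unfolding alt_cone_sum_def by (intro sum.neutral) auto
  next
    case True
    then obtain p where p: "\<forall>i\<in>M. 0 \<le> p i" "u = (\<Sum>i\<in>M. p i *\<^sub>R \<Phi> i)"
      unfolding cone_gen_def by auto
    \<comment> \<open>\<open>\<theta> i\<close> is the time at which coordinate \<open>i\<close> vanishes.  If \<open>p i = y i\<close>, both are zero for
      \<open>i \<in> J\<close>, and the quotient is \<open>0\<close> by convention, which is right: the
      coordinate vanishes from the start.\<close>
    define \<theta> where "\<theta> i = - y i / (p i - y i)" for i
    obtain j where j: "j \<in> J" "\<And>i. i \<in> J \<Longrightarrow> \<theta> j \<le> \<theta> i"
    proof
      show "arg_min_on \<theta> J \<in> J"
        using psubset.prems(1) by (intro arg_min_if_finite(1)) auto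
      show "\<theta> (arg_min_on \<theta> J) \<le> \<theta> i" if "i \<in> J" for i
        using psubset.prems(1) that by (intro arg_min_least) auto
    qed
    define z where "z i = y i + \<theta> j * (p i - y i)" for i
    have ypJ: "y i \<le> 0" "0 \<le> p i" if "i \<in> J" for i
      using that psubset.prems p by auto
    have zi: "y i + \<theta> i * (p i - y i) = 0" if "i \<in> J" for i
      using ypJ[OF that] unfolding \<theta>_def by (cases "p i - y i = 0") auto
    have \<theta>01: "0 \<le> \<theta> j" "\<theta> j \<le> 1"
      unfolding \<theta>_def
      subgoal using ypJ[OF j(1)] by (intro divide_nonneg_nonneg) auto
      subgoal using ypJ[OF j(1)] unfolding divide_le_eq_1 by linarith
      done
    have zj: "z j = 0" unfolding z_def using zi[OF j(1)] .
    have zJ: "z i \<le> 0" if "i \<in> J" for i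
    proof -
      have "\<theta> j * (p i - y i) \<le> \<theta> i * (p i - y i)"
        using j(2)[OF that] ypJ[OF that] by (intro mult_right_mono) auto
      then show ?thesis using zi[OF that] unfolding z_def by simp
    qed
    have zM: "0 \<le> z i" if "i \<in> M - J" for i
    proof -
      have "z i = (1 - \<theta> j) * y i + \<theta> j * p i" unfolding z_def by (simp add: algebra_simps)
      then show ?thesis using psubset.prems(5)[OF that] p(1) that \<theta>01 by auto
    qed
    have "(\<Sum>i\<in>M. z i *\<^sub>R \<Phi> i)
        = (\<Sum>i\<in>M. y i *\<^sub>R \<Phi> i) + \<theta> j *\<^sub>R ((\<Sum>i\<in>M. p i *\<^sub>R \<Phi> i) - (\<Sum>i\<in>M. y i *\<^sub>R \<Phi> i))"
      unfolding z_def by (simp add: algebra_simps sum.distrib sum_subtractf scaleR_sum_right)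
    then have uz: "u = (\<Sum>i\<in>M. z i *\<^sub>R \<Phi> i)"
      using p(2) psubset.prems(3) by simp
    have uz': "u = (\<Sum>i\<in>M - {j}. z i *\<^sub>R \<Phi> i)"
      unfolding uz using zj by (intro sum.mono_neutral_right) auto
    have "alt_cone_sum \<Phi> (J - {j}) M u = alt_cone_sum \<Phi> (J - {j}) (M - {j}) u"
    proof (cases "J = {j}")
      case J: True
      have "u \<in> cone_gen \<Phi> (M - {j})"
        unfolding cone_gen_def using uz' zM J by auto
      then show ?thesis
        using J True assms(1-3) by (simp add: alt_cone_sum_generic)
    next
      case False
      have "J - {j} \<subset> J" using j(1) by auto
      moreover have "J - {j} \<noteq> {}" using False j(1) by auto
      moreover have "J - {j} \<subseteq> M" "J - {j} \<subseteq> M - {j}" using psubset.prems(2) by auto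
      moreover have "\<And>i. i \<in> M - (J - {j}) \<Longrightarrow> 0 \<le> z i"
        using zM zj by force
      ultimately show ?thesis
        using psubset.IH[of "J - {j}" M z] psubset.IH[of "J - {j}" "M - {j}" z] uz uz' zJ by auto
    qed
    then show ?thesis unfolding alt_cone_sum_split[OF j(1)] by simp
  qed
qed

text \<open>
  The positive cone is the image of an open orthant under a surjective linear map.
\<close>
lemma open_pos_cone:
  fixes \<Phi> :: "'n::finite \<Rightarrow> 'a::euclidean_space"
  assumes "span (\<Phi> ` I) = UNIV"
  shows "open (pos_cone \<Phi> I)"
proof -
  define f where "f x = (\<Sum>i\<in>I. (x $ i) *\<^sub>R \<Phi> i)" for x :: "real ^ 'n"
  have "linear f"
    unfolding f_def by (intro linearI) (auto simp: scaleR_add_left sum.distrib scaleR_sum_right)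
  moreover have "surj f"
  proof -
    have "\<exists>x. y = f x" for y
    proof -
      obtain c where "y = (\<Sum>i\<in>I. c i *\<^sub>R \<Phi> i)" using assms in_span_image_iff[of y \<Phi> I] by auto
      then show ?thesis unfolding f_def by (intro exI[of _ "\<chi> i. c i"]) simp
    qed
    then show ?thesis by auto
  qed
  moreover have "open {x :: real ^ 'n. \<forall>i\<in>I. 0 < x $ i}"
  proof -
    have "{x :: real ^ 'n. \<forall>i\<in>I. 0 < x $ i} = (\<Inter>i\<in>I. {x. 0 < x $ i})" by auto
    then show ?thesis by (auto intro!: open_INT open_Collect_less continuous_intros)
  qed
  moreover have "pos_cone \<Phi> I = f ` {x. \<forall>i\<in>I. 0 < x $ i}"
    unfolding pos_cone_def f_def
  proof safe
    fix t :: "'n \<Rightarrow> real" assume "\<forall>i\<in>I. 0 < t i"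
    then show "(\<Sum>i\<in>I. t i *\<^sub>R \<Phi> i) \<in> (\<lambda>x. \<Sum>i\<in>I. (x $ i) *\<^sub>R \<Phi> i) ` {x. \<forall>i\<in>I. 0 < x $ i}"
      by (intro image_eqI[of _ _ "\<chi> i. t i"]) auto
  qed auto
  ultimately show ?thesis using open_surjective_linear_image by metis
qed

section \<open>Topes\<close>

lemma tope_generic: "\<tau> \<in> topes \<Phi> \<Longrightarrow> u \<in> \<tau> \<Longrightarrow> u \<notin> \<Union>(walls \<Phi>)"
  using in_components_subset[of \<tau> "UNIV - \<Union>(walls \<Phi>)"] unfolding topes_def by auto

text \<open>
  On \<open>\<tau>\<close>, which avoids the walls, the closed cone of \<open>I\<close> coincides with its open positive part.  So it
  is open and closed in \<open>\<tau>\<close>, and contains all of the connected set \<open>\<tau>\<close> once it contains one point.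
\<close>
lemma gen_sets_tope:
  fixes \<Phi> :: "'n::finite \<Rightarrow> 'a::euclidean_space"
  assumes spn: "span (range \<Phi>) = UNIV" and \<tau>: "\<tau> \<in> topes \<Phi>" and u: "u \<in> \<tau>"
  shows "gen_sets \<Phi> \<tau> = {I. u \<in> cone_gen \<Phi> I}"
proof -
  have "I \<in> gen_sets \<Phi> \<tau>" if I: "u \<in> cone_gen \<Phi> I" for I
  proof -
    note gen = generic_in_cone[OF spn tope_generic[OF \<tau>]]
    have spI: "span (\<Phi> ` I) = UNIV" using gen(1)[OF u I] .
    have "connected \<tau>" using \<tau> unfolding topes_def by (rule in_components_connected)
    moreover have "open (pos_cone \<Phi> I)" using open_pos_cone[OF spI] .
    moreover have "open (- cone_gen \<Phi> I)" using closed_cone_gen by auto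
    moreover have "\<tau> \<subseteq> pos_cone \<Phi> I \<union> - cone_gen \<Phi> I" using gen(2) by blast
    moreover have "pos_cone \<Phi> I \<inter> - cone_gen \<Phi> I \<inter> \<tau> = {}"
      using pos_cone_subset_cone_gen[of \<Phi> I] by auto
    moreover have "pos_cone \<Phi> I \<inter> \<tau> \<noteq> {}" using gen(2)[OF u I] u by auto
    ultimately have "- cone_gen \<Phi> I \<inter> \<tau> = {}" using connectedD by blast
    then show ?thesis unfolding gen_sets_def using spI by auto
  qed
  then show ?thesis unfolding gen_sets_def using u by auto
qed

text \<open>
  A linear form defining a wall has a constant strict sign on \<open>\<tau>\<close>, hence weakly the same sign on
  the closure.  Every point of the segment from \<open>u\<close> to \<open>l + e *\<^sub>R u\<close> combines \<open>u\<close> with a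
  positive and \<open>l\<close> with a nonnegative weight, so the segment meets no wall.
\<close>
lemma tope_closure_add:
  fixes \<Phi> :: "'n::finite \<Rightarrow> 'a::euclidean_space"
  assumes \<tau>: "\<tau> \<in> topes \<Phi>" and u: "u \<in> \<tau>" and l: "l \<in> closure \<tau>" and e: "e > 0"
  shows "l + e *\<^sub>R u \<in> \<tau>"
proof -
  have avoid: "(1 - t) *\<^sub>R u + t *\<^sub>R (l + e *\<^sub>R u) \<notin> H" if H: "H \<in> walls \<Phi>" and t: "0 \<le> t" "t \<le> 1" for H t
  proof -
    obtain S where S: "H = span S" "independent S" "card S = DIM('a) - 1"
      using H unfolding walls_def by auto
    have "dim S = DIM('a) - 1" using S by (metis dim_eq_card_independent)
    then obtain a where a: "H = {x. a \<bullet> x = 0}" using lowdim_eq_hyperplane S(1) by metis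
    \<comment> \<open>The normal vector \<open>b\<close> will be \<open>a\<close> or \<open>- a\<close>, whichever is positive at \<open>u\<close>.\<close>
    have side: "0 < b \<bullet> ((1 - t) *\<^sub>R u + t *\<^sub>R (l + e *\<^sub>R u))"
      if b: "H = {x. b \<bullet> x = 0}" and pos: "0 < b \<bullet> u" for b
    proof -
      have "0 < b \<bullet> x" if x: "x \<in> \<tau>" for x
      proof (rule ccontr)
        assume "\<not> 0 < b \<bullet> x"
        then obtain z where "z \<in> \<tau>" "b \<bullet> z = 0"
          using connected_ivt_hyperplane[of \<tau> x u b 0] \<tau> x u pos
          unfolding topes_def using in_components_connected by force
        then show False using tope_generic[OF \<tau>, of z] H b by auto
      qed
      then have "\<tau> \<subseteq> {x. 0 \<le> b \<bullet> x}" by force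
      then have "closure \<tau> \<subseteq> {x. 0 \<le> b \<bullet> x}" by (intro closure_minimal closed_halfspace_ge) 
      then have l0: "0 \<le> b \<bullet> l" using l by auto
      have "b \<bullet> ((1 - t) *\<^sub>R u + t *\<^sub>R (l + e *\<^sub>R u)) = ((1 - t) + t * e) * (b \<bullet> u) + t * (b \<bullet> l)"
        by (simp add: inner_add_right algebra_simps)
      moreover have "0 < (1 - t) + t * e" using t e
        by (cases "t = 1") (auto intro: add_pos_nonneg)
      ultimately show ?thesis using l0 t pos by (simp add: add_pos_nonneg)
    qed
    have "a \<bullet> u \<noteq> 0" using tope_generic[OF \<tau> u] H a by auto
    then consider "0 < a \<bullet> u" | "0 < (- a) \<bullet> u" by fastforce
    then show ?thesis
    proof cases
      case 1
      then show ?thesis using side[OF a] a by auto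
    next
      case 2
      have "H = {x. (- a) \<bullet> x = 0}" using a by simp
      then show ?thesis using side[OF _ 2] by auto
    qed
  qed
  have "closed_segment u (l + e *\<^sub>R u) \<subseteq> \<tau>"
  proof (rule components_maximal)
    show "\<tau> \<in> components (UNIV - \<Union>(walls \<Phi>))" using \<tau> unfolding topes_def .
    show "closed_segment u (l + e *\<^sub>R u) \<subseteq> UNIV - \<Union>(walls \<Phi>)"
      using avoid unfolding closed_segment_def by auto
    show "\<tau> \<inter> closed_segment u (l + e *\<^sub>R u) \<noteq> {}" using u by auto
  qed auto
  then show ?thesis by auto
qed

section \<open>Evaluation of the alternating sum of orthants\<close>

text \<open>
  Otherwise the cone would contain the line spanned by \<open>\<Phi> j\<close>.
\<close>
lemma salient_neg_notin:
  assumes "salient (cone_gen \<Phi> UNIV)" "\<Phi> j \<noteq> 0"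
  shows "- \<Phi> j \<notin> cone_gen \<Phi> UNIV"
proof
  assume neg: "- \<Phi> j \<in> cone_gen \<Phi> UNIV"
  have pos: "\<Phi> j \<in> cone_gen \<Phi> UNIV" unfolding cone_gen_eq_hull by (simp add: hull_inc)
  have "t *\<^sub>R \<Phi> j \<in> cone_gen \<Phi> UNIV" for t
  proof (cases "t \<ge> 0")
    case True
    then show ?thesis using pos unfolding cone_gen_eq_hull by (intro convex_cone_hull_mul)
  next
    case False
    then have "(- t) *\<^sub>R (- \<Phi> j) \<in> cone_gen \<Phi> UNIV"
      using neg unfolding cone_gen_eq_hull by (intro convex_cone_hull_mul) auto
    then show ?thesis by simp
  qed
  then have "range (\<lambda>t. 0 + t *\<^sub>R \<Phi> j) \<subseteq> cone_gen \<Phi> UNIV" by auto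
  then show False using assms unfolding salient_def by blast
qed

lemma \<X>_eq_alt_cone_sum:
  fixes \<Phi> :: "'n::finite \<Rightarrow> 'a::euclidean_space"
  assumes spn: "span (range \<Phi>) = UNIV" and \<tau>: "\<tau> \<in> topes \<Phi>" and u: "u \<in> \<tau>"
  shows "\<X> \<Phi> \<tau> x = (-1) ^ DIM('a) * alt_cone_sum \<Phi> {j. x $ j < 0} UNIV u"
proof -
  let ?J = "{j. x $ j < 0}"
  have sgn: "(-1) ^ (card I - DIM('a)) = (-1) ^ DIM('a) * (-1 :: real) ^ card I"
    if "I \<in> gen_sets \<Phi> \<tau>" for I
  proof -
    have "DIM('a) = dim (\<Phi> ` I)" using that unfolding gen_sets_def by (metis (mono_tags, lifting) dim_UNIV dim_span mem_Collect_eq)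
    also have "\<dots> \<le> card (\<Phi> ` I)" by (intro dim_le_card') auto
    also have "\<dots> \<le> card I" by (intro card_image_le) auto
    finally have "card I = DIM('a) + (card I - DIM('a))" by simp
    then have "(-1 :: real) ^ card I = (-1) ^ DIM('a) * (-1) ^ (card I - DIM('a))" by (metis power_add)
    then show ?thesis by (simp add: power_mult_distrib[symmetric] mult.assoc[symmetric])
  qed
  have prd: "(\<Prod>j\<in>-I. indicator {y. 0 \<le> y $ j} x) = (of_bool (?J \<subseteq> I) :: real)" for I
  proof (cases "?J \<subseteq> I")
    case True
    then have "(\<Prod>j\<in>-I. indicator {y. 0 \<le> y $ j} x) = (\<Prod>j\<in>-I. 1 :: real)"
      by (intro prod.cong) (auto simp: indicator_def not_less[symmetric])
    then show ?thesis using True by simp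
  next
    case False
    then obtain j where "x $ j < 0" "j \<notin> I" by auto
    then have "(\<Prod>j\<in>-I. indicator {y. 0 \<le> y $ j} x) = (0::real)"
      by (intro prod_zero) (auto intro!: bexI[of _ j])
    then show ?thesis using False by simp
  qed
  have "\<X> \<Phi> \<tau> x = (\<Sum>I\<in>gen_sets \<Phi> \<tau>. (-1) ^ DIM('a) * ((-1) ^ card I * of_bool (?J \<subseteq> I)))"
    unfolding \<X>_def prd by (intro sum.cong) (simp_all add: sgn)
  also have "\<dots> = (\<Sum>I | ?J \<subseteq> I \<and> I \<subseteq> UNIV. (-1) ^ DIM('a) * ((-1) ^ card I * of_bool (u \<in> cone_gen \<Phi> I)))"
    unfolding gen_sets_tope[OF assms] by (intro sum.mono_neutral_cong) auto
  finally show ?thesis unfolding alt_cone_sum_def by (simp only: sum_distrib_left)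
qed

text \<open>
  The common core of both parts of the theorem.  The coordinates \<open>y\<close> need not be those of \<open>x\<close>:
  they describe a nearby point over \<open>\<tau>\<close>, and must agree with \<open>x\<close> in sign only weakly.
\<close>
lemma \<X>_eq_of_signs:
  fixes \<Phi> :: "'n::finite \<Rightarrow> 'a::euclidean_space"
  assumes pointed: "\<And>j. - \<Phi> j \<notin> cone_gen \<Phi> UNIV" and spn: "span (range \<Phi>) = UNIV"
    and \<tau>: "\<tau> \<in> topes \<Phi>" "\<tau> \<subseteq> cone_gen \<Phi> UNIV"
    and y: "(\<Sum>i\<in>UNIV. y i *\<^sub>R \<Phi> i) \<in> \<tau>"
      "\<And>i. x $ i < 0 \<Longrightarrow> y i \<le> 0" "\<And>i. 0 \<le> x $ i \<Longrightarrow> 0 \<le> y i"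
  shows "\<X> \<Phi> \<tau> x = of_bool (\<forall>i. 0 \<le> x $ i)"
proof (cases "\<forall>i. 0 \<le> x $ i")
  case True
  then have "{j. x $ j < 0} = {}" by (auto simp: not_less)
  then have "\<X> \<Phi> \<tau> x = (-1) ^ DIM('a) * (-1) ^ DIM('a)"
    unfolding \<X>_eq_alt_cone_sum[OF spn \<tau>(1) y(1)] 
    using alt_cone_sum_generic[OF pointed spn tope_generic[OF \<tau>(1) y(1)], of UNIV] \<tau>(2) y(1) by auto
  then show ?thesis using True by (simp add: power_mult_distrib[symmetric])
next
  case False
  have "alt_cone_sum \<Phi> {j. x $ j < 0} UNIV (\<Sum>i\<in>UNIV. y i *\<^sub>R \<Phi> i) = 0"
    using False y
    by (intro alt_cone_sum_eq_0[where y = y, OF pointed spn tope_generic[OF \<tau>(1) y(1)]]) (auto simp: not_less not_le intro: refl)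
  then show ?thesis
    using False unfolding \<X>_eq_alt_cone_sum[OF spn \<tau>(1) y(1)] by simp
qed

theorem corollary21:
  fixes \<Phi> :: "'n::finite \<Rightarrow> 'a::euclidean_space" and \<tau> :: "'a set"
  assumes "\<And>j. \<Phi> j \<noteq> 0"
    and "span (range \<Phi>) = UNIV"
    and "salient (cone_gen \<Phi> UNIV)"
    and "\<tau> \<in> topes \<Phi>"
    and "\<tau> \<subseteq> cone_gen \<Phi> UNIV"
  shows "(\<forall>l \<in> closure \<tau>.
            (\<lambda>x. \<X> \<Phi> \<tau> x * indicator (fiber \<Phi> l) x)
              = indicator (partition_polytope \<Phi> l))
       \<and> (\<forall>l \<in> {u - v |u v. u \<in> \<tau> \<and> v \<in> zonotope \<Phi>}.
            (\<lambda>x. \<X> \<Phi> \<tau> x * indicator (fiber \<Phi> l) x * indicator int_lattice x)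
              = indicator (partition_polytope \<Phi> l \<inter> int_lattice))"
proof (intro conjI ballI ext)
  note signs = \<X>_eq_of_signs[OF salient_neg_notin[OF assms(3,1)] assms(2,4,5)]
  fix l x assume l: "l \<in> closure \<tau>"
  show "\<X> \<Phi> \<tau> x * indicator (fiber \<Phi> l) x = indicator (partition_polytope \<Phi> l) x"
  proof (cases "x \<in> fiber \<Phi> l")
    case True
    have "\<tau> \<noteq> {}" using assms(4) unfolding topes_def by (rule in_components_nonempty)
    then obtain u where u: "u \<in> \<tau>" by auto
    obtain t where t: "\<forall>i. 0 \<le> t i" "u = (\<Sum>i\<in>UNIV. t i *\<^sub>R \<Phi> i)"
      using u assms(5) unfolding cone_gen_def by auto
    \<comment> \<open>Coordinates that are zero in \<open>x\<close> may only be moved upwards; this is why \<open>x\<close> is shifted by nonnegative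
      coordinates \<open>t\<close>.  The step \<open>e\<close> has to be small only for the negative ones.\<close>
    have "eventually (\<lambda>e. \<forall>i\<in>{i. x $ i < 0}. x $ i + e * t i < 0) (at_right (0::real))"
    proof (intro eventually_ball_finite ballI)
      fix i assume "i \<in> {i. x $ i < 0}"
      moreover have "((\<lambda>e. x $ i + e * t i) \<longlongrightarrow> x $ i + 0 * t i) (at_right (0::real))"
        by (intro tendsto_intros)
      ultimately show "eventually (\<lambda>e. x $ i + e * t i < 0) (at_right (0::real))"
        by (auto dest: order_tendstoD(2)[where a = 0])
    qed simp
    then have "eventually (\<lambda>e. e > 0 \<and> (\<forall>i\<in>{i. x $ i < 0}. x $ i + e * t i < 0)) (at_right (0::real))"
      using eventually_at_right_less by (rule eventually_conj[rotated])
    then obtain e where e: "e > 0" "\<And>i. x $ i < 0 \<Longrightarrow> x $ i + e * t i < 0"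
      using eventually_happens' by (metis (mono_tags, lifting) mem_Collect_eq trivial_limit_at_right_real)
    have "l + e *\<^sub>R u = (\<Sum>i\<in>UNIV. (x $ i + e * t i) *\<^sub>R \<Phi> i)"
      using True t(2) unfolding fiber_def by (auto simp: scaleR_add_left sum.distrib scaleR_sum_right)
    then have "(\<Sum>i\<in>UNIV. (x $ i + e * t i) *\<^sub>R \<Phi> i) \<in> \<tau>"
      using tope_closure_add[OF assms(4) u l e(1)] by simp
    from signs[OF this, of x] have "\<X> \<Phi> \<tau> x = of_bool (\<forall>i. 0 \<le> x $ i)"
      using e t(1) by (auto simp: less_imp_le)
    then show ?thesis using True unfolding partition_polytope_def by (auto simp: indicator_def)
  qed (auto simp: partition_polytope_def)
next
  note signs = \<X>_eq_of_signs[OF salient_neg_notin[OF assms(3,1)] assms(2,4,5)]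
  fix l x assume "l \<in> {u - v |u v. u \<in> \<tau> \<and> v \<in> zonotope \<Phi>}"
  then obtain u t where u: "u \<in> \<tau>" "l = u - (\<Sum>i\<in>UNIV. t i *\<^sub>R \<Phi> i)" and t: "\<forall>i. 0 \<le> t i \<and> t i \<le> 1"
    unfolding zonotope_def by auto
  show "\<X> \<Phi> \<tau> x * indicator (fiber \<Phi> l) x * indicator int_lattice x
      = indicator (partition_polytope \<Phi> l \<inter> int_lattice) x"
  proof (cases "x \<in> fiber \<Phi> l \<inter> int_lattice")
    case True
    have "u = (\<Sum>i\<in>UNIV. (x $ i + t i) *\<^sub>R \<Phi> i)"
      using True u(2) unfolding fiber_def by (auto simp: scaleR_add_left sum.distrib)
    then have "(\<Sum>i\<in>UNIV. (x $ i + t i) *\<^sub>R \<Phi> i) \<in> \<tau>" using u(1) by simp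
    moreover have "x $ i + t i \<le> 0" if "x $ i < 0" for i
    proof -
      obtain k :: int where k: "x $ i = of_int k"
        using True unfolding int_lattice_def by (auto elim: Ints_cases)
      then have "x $ i \<le> -1" using that by simp
      then show ?thesis using t by (smt (verit))
    qed
    ultimately have "\<X> \<Phi> \<tau> x = of_bool (\<forall>i. 0 \<le> x $ i)"
      using t by (intro signs[where y = "\<lambda>i. x $ i + t i"]) auto
    then show ?thesis using True unfolding partition_polytope_def by (auto simp: indicator_def)
  qed (auto simp: partition_polytope_def)
qed

end
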